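(* Let $\mathbb{K}$ be a field, let $V$ be a vector space over $\mathbb{K}$ with finite positive dimension, let $A, A^*$ be a Leonard pair on $V$, and let $d=\dim V-1$. Fix a basis $v^*_0,\ldots,v^*_d$ of $V$ with respect to which $A$ is irreducible tridiagonal, with $(i-1,i)$-entries $b_{i-1}$ and $(i,i-1)$-entries $c_i$ ($1\le i\le d$), and $A^*$ is $\mathrm{diag}(\theta^*_0,\ldots,\theta^*_d)$. Fix a basis $v_0,\ldots,v_d$ of $V$ with respect to which $A^*$ is irreducible tridiagonal, with $(i-1,i)$-entries $b^*_{i-1}$ and $(i,i-1)$-entries $c^*_i$ ($1\le i\le d$), and $A$ is $\mathrm{diag}(\theta_0,\ldots,\theta_d)$. Suppose $d$ is even. (i) The null space of $AA^*-A^*A$ is spanned by $\sum_{k=0}^d\gamma_k v^*_k$, where $\gamma_k=0$ if $k$ is odd, and $$\gamma_k=\prod_{\substack{1\le i\le k-1\\ i\text{ odd}}}\frac{c_i(\theta^*_{i-1}-\theta^*_i)}{b_i(\theta^*_i-\theta^*_{i+1})}$$ if $k$ is even. (ii) The null space of $AA^*-A^*A$ is spanned by $\sum_{k=0}^d\gamma^*_k v_k$, where $\gamma^*_k=0$ if $k$ is odd, and $$\gamma^*_k=\prod_{\substack{1\le i\le k-1\\ i\text{ odd}}}\frac{c^*_i(\theta_{i-1}-\theta_i)}{b^*_i(\theta_i-\theta_{i+1})}$$ if $k$ is even.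
   Context: A square matrix is tridiagonal if each nonzero entry lies on the diagonal, the subdiagonal or the superdiagonal; a tridiagonal matrix is irreducible if each entry on the subdiagonal is nonzero and each entry on the superdiagonal is nonzero. A Leonard pair on $V$ is an ordered pair of linear transformations $A:V\to V$ and $A^*:V\to V$ such that: (i) there exists a basis for $V$ with respect to which the matrix representing $A$ is irreducible tridiagonal and the matrix representing $A^*$ is diagonal; (ii) there exists a basis for $V$ with respect to which the matrix representing $A^*$ is irreducible tridiagonal and the matrix representing $A$ is diagonal. Here $A^*$ is just a name for a second linear transformation; it does not denote the conjugate-transpose or adjoint of $A$. Rows and columns of $(d+1)\times(d+1)$ matrices are indexed by $0,1,\ldots,d$. A matrix $Y$ represents $X:V\to V$ with respect to a basis $u_0,\ldots,u_d$ if $Xu_j=\sum_{i=0}^d Y_{ij}u_i$ for $0\le j\le d$. The null space of $X$ is $\{v\in V\mid Xv=0\}$. It is known that $\theta_0,\ldots,\theta_d$ are mutually distinct and $\theta^*_0,\ldots,\theta^*_d$ are mutually distinct. Empty products equal $1$. *)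

theory Defs
  imports "Jordan_Normal_Form.Matrix"
begin

definition tridiagonal_mat :: "'a::zero mat \<Rightarrow> bool" where
  "tridiagonal_mat M \<longleftrightarrow> square_mat M \<and>
     (\<forall>i<dim_row M. \<forall>j<dim_col M. M $$ (i, j) \<noteq> 0 \<longrightarrow> i = j \<or> i = Suc j \<or> j = Suc i)"

definition irreducible_tridiagonal_mat :: "'a::zero mat \<Rightarrow> bool" where
  "irreducible_tridiagonal_mat M \<longleftrightarrow> tridiagonal_mat M \<and>
     (\<forall>i. Suc i < dim_row M \<longrightarrow> M $$ (Suc i, i) \<noteq> 0 \<and> M $$ (i, Suc i) \<noteq> 0)"

text \<open>
  The vector space is the whole type \<open>'v\<close> with scalar multiplication \<open>scale\<close>.
  Bases are ordered families indexed by \<open>0, \<dots>, d\<close>; values beyond \<open>d\<close> are irrelevant.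
\<close>

definition basis_family ::
  "('k::field \<Rightarrow> 'v::ab_group_add \<Rightarrow> 'v) \<Rightarrow> nat \<Rightarrow> (nat \<Rightarrow> 'v) \<Rightarrow> bool" where
  "basis_family scale d u \<longleftrightarrow> inj_on u {0..d} \<and>
     \<not> module.dependent scale (u ` {0..d}) \<and> module.span scale (u ` {0..d}) = UNIV"

definition mat_represents ::
  "('k::field \<Rightarrow> 'v::ab_group_add \<Rightarrow> 'v) \<Rightarrow> nat \<Rightarrow> (nat \<Rightarrow> 'v) \<Rightarrow> 'k mat \<Rightarrow> ('v \<Rightarrow> 'v) \<Rightarrow> bool" where
  "mat_represents scale d u Y X \<longleftrightarrow> Y \<in> carrier_mat (d + 1) (d + 1) \<and>
     (\<forall>j\<in>{0..d}. X (u j) = (\<Sum>i=0..d. scale (Y $$ (i, j)) (u i)))"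

text \<open>
  The library's \<open>dim\<close> is \<open>0\<close> for infinite-dimensional spaces, so \<open>0 < dim UNIV\<close> says that
  the dimension is finite and positive.
\<close>

definition leonard_pair ::
  "('k::field \<Rightarrow> 'v::ab_group_add \<Rightarrow> 'v) \<Rightarrow> ('v \<Rightarrow> 'v) \<Rightarrow> ('v \<Rightarrow> 'v) \<Rightarrow> bool" where
  "leonard_pair scale A As \<longleftrightarrow>
     vector_space scale \<and> 0 < vector_space.dim scale (UNIV :: 'v set) \<and>
     Vector_Spaces.linear scale scale A \<and> Vector_Spaces.linear scale scale As \<and>
     (let d = vector_space.dim scale (UNIV :: 'v set) - 1 in
       (\<exists>u Y Z. basis_family scale d u \<and>
          mat_represents scale d u Y A \<and> irreducible_tridiagonal_mat Y \<and>
          mat_represents scale d u Z As \<and> diagonal_mat Z) \<and>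
       (\<exists>u Y Z. basis_family scale d u \<and>
          mat_represents scale d u Y As \<and> irreducible_tridiagonal_mat Y \<and>
          mat_represents scale d u Z A \<and> diagonal_mat Z))"

definition null_space :: "('v::zero \<Rightarrow> 'v) \<Rightarrow> 'v set" where
  "null_space X = {v. X v = 0}"

end

theory Submission
  imports Defs
begin

text \<open>
  Write a vector as \<open>x = \<Sum>k. a k \<cdot> v\<^sup>*\<^sub>k\<close> in the basis that diagonalises \<open>A\<^sup>*\<close>. Since \<open>A\<close> is tridiagonal
  there, the \<open>i\<close>-th coordinate of \<open>(A A\<^sup>* - A\<^sup>* A) x\<close> has no \<open>a i\<close> term: the diagonal entry of \<open>A\<close> is
  multiplied by \<open>\<theta>\<^sup>*\<^sub>i - \<theta>\<^sup>*\<^sub>i = 0\<close>. Hence \<open>x\<close> lies in the null space exactly when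
  \<open>c\<^sub>i (\<theta>\<^sup>*\<^bsub>i-1\<^esub> - \<theta>\<^sup>*\<^sub>i) a\<^bsub>i-1\<^esub> = b\<^sub>i (\<theta>\<^sup>*\<^sub>i - \<theta>\<^sup>*\<^bsub>i+1\<^esub>) a\<^bsub>i+1\<^esub>\<close> for \<open>0 \<le> i \<le> d\<close>, with the term on
  the left absent for \<open>i = 0\<close> and the term on the right absent for \<open>i = d\<close>. These equations link
  only indices of equal parity. The even-numbered ones start with \<open>a\<^sub>1 = 0\<close> and kill all odd
  coordinates. The odd-numbered ones determine all even coordinates from \<open>a\<^sub>0\<close>, with the stated
  products as ratios. As \<open>d\<close> is even, the last equation, \<open>i = d\<close>, concerns an odd
  coordinate and imposes nothing on the even ones
  (\<open>two_step_recurrence_iff\<close>, \<open>null_space_commutator\<close>).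

  Solving for \<open>a\<^bsub>i+1\<^esub>\<close> requires \<open>\<theta>\<^sup>*\<^sub>i \<noteq> \<theta>\<^sup>*\<^bsub>i+1\<^esub>\<close>. This is where the second basis enters: with
  respect to it \<open>A\<^sup>*\<close> is irreducible tridiagonal, so an eigenvector is determined by its
  \<open>0\<close>-th coordinate, eigenspaces are lines, and the eigenvalues \<open>\<theta>\<^sup>*\<^sub>i\<close> are distinct
  (\<open>diagonal_entries_distinct\<close>).

  The second claim is the first one with the roles of \<open>A\<close> and \<open>A\<^sup>*\<close> exchanged, because the
  commutator only changes its sign.
\<close>

section \<open>Tridiagonal rows and two-step recurrences\<close>

lemma tridiagonal_mat_row_sum:
  fixes Y :: "'a::field mat"
  assumes Y: "Y \<in> carrier_mat (d + 1) (d + 1)" and tri: "tridiagonal_mat Y" and i: "i \<le> d"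
  shows "(\<Sum>j=0..d. Y $$ (i, j) * f j) =
    (if i = 0 then 0 else Y $$ (i, i - 1) * f (i - 1)) + Y $$ (i, i) * f i +
    (if i < d then Y $$ (i, i + 1) * f (i + 1) else 0)"
proof -
  have zero: "Y $$ (i, j) = 0" if "j \<le> d" "i \<noteq> j" "i \<noteq> Suc j" "j \<noteq> Suc i" for j
    using tri[unfolded tridiagonal_mat_def, THEN conjunct2, rule_format, of i j] Y i that by auto
  let ?S = "(if i = 0 then {} else {i - 1}) \<union> {i} \<union> (if i < d then {i + 1} else {})"
  have "Y $$ (i, j) * f j = 0" if "j \<in> {0..d} - ?S" for j
    using that i zero[of j] by (cases "i = 0"; cases "i < d") auto
  then have "(\<Sum>j=0..d. Y $$ (i, j) * f j) = (\<Sum>j\<in>?S. Y $$ (i, j) * f j)"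
    using i by (intro sum.mono_neutral_right) auto
  also have "\<dots> = (if i = 0 then 0 else Y $$ (i, i - 1) * f (i - 1)) + Y $$ (i, i) * f i +
    (if i < d then Y $$ (i, i + 1) * f (i + 1) else 0)"
    by (cases "i = 0"; cases "i < d") (simp_all add: algebra_simps)
  finally show ?thesis .
qed

text \<open>
  The system splits by parity, since it links the neighbours of \<open>i\<close> only with each other.
  The truncated difference \<open>k - 1\<close> makes the product empty for \<open>k = 0\<close>.
\<close>

lemma two_step_recurrence_iff:
  fixes p q a :: "nat \<Rightarrow> 'a::field"
  assumes q: "\<And>i. i < d \<Longrightarrow> q i \<noteq> 0" and d: "even d"
  shows "(\<forall>i\<le>d. (if i = 0 then 0 else p i * a (i - 1)) = (if i < d then q i * a (i + 1) else 0))
    \<longleftrightarrow> (\<forall>k\<le>d. a k = a 0 * (if odd k then 0 else \<Prod>i\<in>{i. 1 \<le> i \<and> i \<le> k - 1 \<and> odd i}. p i / q i))"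
    (is "?rec \<longleftrightarrow> (\<forall>k\<le>d. a k = a 0 * ?g k)")
proof -
  define g where "g k = ?g k" for k
  have "{i::nat. 1 \<le> i \<and> i \<le> 0 - 1 \<and> odd i} = {}" by auto
  then have g_0: "g 0 = 1" unfolding g_def by (simp only: prod.empty) simp
  have g_odd: "g k = 0" if "odd k" for k using that by (simp add: g_def)
  have g_step: "g (Suc (Suc k)) = g k * (p (Suc k) / q (Suc k))" if "even k" for k
  proof -
    have "i \<le> Suc (Suc k) - 1 \<longleftrightarrow> i = Suc k \<or> i \<le> k - 1" if "odd i" for i
      using that \<open>even k\<close> by (cases "i = k") auto
    then have "{i. 1 \<le> i \<and> i \<le> Suc (Suc k) - 1 \<and> odd i} =
        insert (Suc k) {i. 1 \<le> i \<and> i \<le> k - 1 \<and> odd i}"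
      using that by auto
    moreover have "finite {i. 1 \<le> i \<and> i \<le> k - 1 \<and> odd i}"
      by (rule finite_subset[of _ "{..k}"]) auto
    moreover have "Suc k \<notin> {i. 1 \<le> i \<and> i \<le> k - 1 \<and> odd i}" by auto
    ultimately show ?thesis using that by (simp add: g_def)
  qed
  have "?rec \<longleftrightarrow> (\<forall>k\<le>d. a k = a 0 * g k)"
  proof (intro iffI allI impI)
    fix k assume rec: ?rec and "k \<le> d"
    then show "a k = a 0 * g k"
    proof (induction k rule: induct_nat_012)
      case 0
      show ?case by (simp add: g_0)
    next
      case 1
      then show ?case using rec[rule_format, of 0] q[of 0] by (simp add: g_odd)
    next
      case (ge2 k)
      then have "p (Suc k) * a k = q (Suc k) * a (Suc (Suc k))"
        using rec[rule_format, of "Suc k"] by simp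
      moreover have "q (Suc k) \<noteq> 0" using q ge2.prems by simp
      ultimately have "a (Suc (Suc k)) = a k * (p (Suc k) / q (Suc k))"
        by (simp add: field_simps)
      moreover have "a k = a 0 * g k" using ge2 by simp
      ultimately show ?case by (cases "even k") (simp_all add: g_step g_odd)
    qed
  next
    fix i assume sol: "\<forall>k\<le>d. a k = a 0 * g k" and i: "i \<le> d"
    have odd0: "a k = 0" if "odd k" "k \<le> d" for k
      using sol[rule_format, OF that(2)] g_odd[OF that(1)] by simp
    show "(if i = 0 then 0 else p i * a (i - 1)) = (if i < d then q i * a (i + 1) else 0)"
    proof (cases "even i")
      case True
      then have "odd (i - 1)" if "i \<noteq> 0" using that by simp
      then show ?thesis using True i odd0[of "i - 1"] odd0[of "i + 1"] by auto
    next
      case False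
      then obtain k where k: "i = Suc k" "even k" by (cases i) auto
      \<comment> \<open>An odd index is not the last one because \<open>d\<close> is even.\<close>
      have "i < d" using False d i by (metis le_neq_implies_less)
      then have "a (Suc (Suc k)) = a 0 * g (Suc (Suc k))" "a k = a 0 * g k"
        using sol[rule_format, of "Suc (Suc k)"] sol[rule_format, of k] k by simp_all
      then have "a (Suc (Suc k)) = a k * (p i / q i)" using k by (simp add: g_step)
      then show ?thesis using \<open>i < d\<close> k q[of i] by (simp add: field_simps)
    qed
  qed
  then show ?thesis unfolding g_def .
qed

section \<open>Coordinates with respect to a basis\<close>

context vector_space
begin

lemma basis_family_expansion:
  assumes "basis_family scale d u"
  obtains a where "x = (\<Sum>k=0..d. a k *s u k)"
proof -
  have inj: "inj_on u {0..d}" and "x \<in> span (u ` {0..d})"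
    using assms unfolding basis_family_def by auto
  then obtain g where "x = (\<Sum>w\<in>u ` {0..d}. g w *s w)"
    by (auto simp: span_finite)
  then show thesis using that[of "g \<circ> u"] by (simp add: sum.reindex[OF inj])
qed

lemma basis_family_sum_eq_0_iff:
  assumes "basis_family scale d u"
  shows "(\<Sum>k=0..d. a k *s u k) = 0 \<longleftrightarrow> (\<forall>k\<le>d. a k = 0)"
proof
  have inj: "inj_on u {0..d}" and ind: "independent (u ` {0..d})"
    using assms unfolding basis_family_def by auto
  assume zero: "(\<Sum>k=0..d. a k *s u k) = 0"
  let ?g = "\<lambda>w. a (inv_into {0..d} u w)"
  have "(\<Sum>w\<in>u ` {0..d}. ?g w *s w) = 0"
    using zero by (simp add: sum.reindex[OF inj] inj)
  then have "\<forall>w\<in>u ` {0..d}. ?g w = 0"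
    using ind by (subst (asm) dependent_finite) auto
  then show "\<forall>k\<le>d. a k = 0" by (simp add: inj)
qed simp

lemma basis_family_nonzero:
  assumes "basis_family scale d u" and "k \<le> d"
  shows "u k \<noteq> 0"
proof
  assume "u k = 0"
  then have "0 \<in> u ` {0..d}" using \<open>k \<le> d\<close> by force
  then show False using assms dependent_zero unfolding basis_family_def by blast
qed

lemma mat_represents_sum:
  assumes lin: "Vector_Spaces.linear scale scale X" and rep: "mat_represents scale d u Y X"
  shows "X (\<Sum>j=0..d. a j *s u j) = (\<Sum>i=0..d. (\<Sum>j=0..d. Y $$ (i, j) * a j) *s u i)"
proof -
  interpret X: Vector_Spaces.linear scale scale X by (rule lin)
  have "X (\<Sum>j=0..d. a j *s u j) = (\<Sum>j=0..d. a j *s (\<Sum>i=0..d. Y $$ (i, j) *s u i))"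
    using rep unfolding mat_represents_def by (simp add: X.sum X.scale)
  also have "\<dots> = (\<Sum>j=0..d. \<Sum>i=0..d. (Y $$ (i, j) * a j) *s u i)"
    by (simp add: scale_sum_right mult.commute)
  also have "\<dots> = (\<Sum>i=0..d. (\<Sum>j=0..d. Y $$ (i, j) * a j) *s u i)"
    by (subst sum.swap) (simp add: scale_sum_left)
  finally show ?thesis .
qed

lemma mat_represents_diag_sum:
  assumes lin: "Vector_Spaces.linear scale scale X"
    and rep: "mat_represents scale d u (mat_diag (d + 1) t) X"
  shows "X (\<Sum>j=0..d. a j *s u j) = (\<Sum>i=0..d. (t i * a i) *s u i)"
proof -
  have "(\<Sum>j=0..d. mat_diag (d + 1) t $$ (i, j) * a j) = t i * a i" if "i \<le> d" for i
  proof -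
    have "(\<Sum>j=0..d. mat_diag (d + 1) t $$ (i, j) * a j) = (\<Sum>j=0..d. if j = i then t j * a j else 0)"
      using that by (intro sum.cong) (auto simp: mat_diag_def)
    then show ?thesis using that by simp
  qed
  then show ?thesis unfolding mat_represents_sum[OF lin rep] by (intro sum.cong) auto
qed

lemma mat_represents_diag_eigenvector:
  assumes rep: "mat_represents scale d u (mat_diag (d + 1) t) X" and i: "i \<le> d"
  shows "X (u i) = t i *s u i"
proof -
  have "X (u i) = (\<Sum>k=0..d. mat_diag (d + 1) t $$ (k, i) *s u k)"
    using rep i unfolding mat_represents_def by simp
  also have "\<dots> = (\<Sum>k=0..d. if k = i then t k *s u k else 0)"
    using i by (intro sum.cong) (auto simp: mat_diag_def)
  finally show ?thesis using i by simp
qed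

section \<open>Distinctness of the eigenvalues\<close>

text \<open>
  Row \<open>i\<close> of the eigenvalue equation expresses coordinate \<open>i + 1\<close> through the coordinates
  \<open>i - 1\<close> and \<open>i\<close>, since the superdiagonal entry is invertible; so a vanishing first coordinate
  propagates to all others.
\<close>

lemma irreducible_tridiagonal_eigenvector_eq_0:
  assumes lin: "Vector_Spaces.linear scale scale X" and basis: "basis_family scale d u"
    and rep: "mat_represents scale d u Y X" and irr: "irreducible_tridiagonal_mat Y"
    and eig: "X (\<Sum>j=0..d. a j *s u j) = t *s (\<Sum>j=0..d. a j *s u j)" and a0: "a 0 = 0"
  shows "(\<Sum>j=0..d. a j *s u j) = 0"
proof -
  have Y: "Y \<in> carrier_mat (d + 1) (d + 1)" and tri: "tridiagonal_mat Y"
    using rep irr unfolding mat_represents_def irreducible_tridiagonal_mat_def by auto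
  have "(\<Sum>i=0..d. ((\<Sum>j=0..d. Y $$ (i, j) * a j) - t * a i) *s u i) = 0"
    using eig unfolding mat_represents_sum[OF lin rep]
    by (simp add: scale_left_diff_distrib sum_subtractf scale_sum_right)
  then have row: "(\<Sum>j=0..d. Y $$ (i, j) * a j) = t * a i" if "i \<le> d" for i
    using that unfolding basis_family_sum_eq_0_iff[OF basis] by simp
  have "a k = 0" if "k \<le> d" for k
    using that
  proof (induction k rule: less_induct)
    case (less k)
    show ?case
    proof (cases k)
      case 0
      then show ?thesis using a0 by simp
    next
      case (Suc i)
      then have "a i = 0" and "i = 0 \<or> a (i - Suc 0) = 0" and i: "i < d"
        using less by auto
      then have "Y $$ (i, Suc i) * a (Suc i) = 0"
        using row[of i] tridiagonal_mat_row_sum[OF Y tri, of i a] by (auto split: if_splits)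
      moreover have "Y $$ (i, Suc i) \<noteq> 0"
        using irr Y i unfolding irreducible_tridiagonal_mat_def by auto
      ultimately show ?thesis using Suc by simp
    qed
  qed
  then show ?thesis by simp
qed

text \<open>
  If two basis vectors of \<open>u\<close> shared an eigenvalue, some nontrivial combination of them would have
  a vanishing first coordinate in the basis \<open>w\<close>. Like the two vectors it satisfies the eigenvalue
  equation, so it would be zero, against linear independence.
\<close>

lemma diagonal_entries_distinct:
  assumes lin: "Vector_Spaces.linear scale scale X"
    and u: "basis_family scale d u" and diag: "mat_represents scale d u (mat_diag (d + 1) t) X"
    and w: "basis_family scale d w" and rep: "mat_represents scale d w Y X"
    and irr: "irreducible_tridiagonal_mat Y"
  shows "inj_on t {0..d}"
proof (rule inj_onI, rule ccontr)
  interpret X: Vector_Spaces.linear scale scale X by (rule lin)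
  fix i j assume ij: "i \<in> {0..d}" "j \<in> {0..d}" "t i = t j" "i \<noteq> j"
  obtain f where f: "u i = (\<Sum>k=0..d. f k *s w k)" by (rule basis_family_expansion[OF w])
  obtain g where g: "u j = (\<Sum>k=0..d. g k *s w k)" by (rule basis_family_expansion[OF w])
  \<comment> \<open>The combination of the two eigenvectors is chosen to cancel the first coordinate in \<open>w\<close>.\<close>
  define h where "h k = g 0 * f k - f 0 * g k" for k
  have h: "(\<Sum>k=0..d. h k *s w k) = g 0 *s u i - f 0 *s u j"
    unfolding f g h_def by (simp add: scale_left_diff_distrib sum_subtractf scale_sum_right)
  have "X (g 0 *s u i - f 0 *s u j) = t i *s (g 0 *s u i - f 0 *s u j)"
    using ij mat_represents_diag_eigenvector[OF diag]
    by (simp add: X.diff X.scale scale_right_diff_distrib mult.commute)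
  then have "(\<Sum>k=0..d. h k *s w k) = 0"
    by (intro irreducible_tridiagonal_eigenvector_eq_0[OF lin w rep irr, where t = "t i"])
      (simp_all only: h, simp add: h_def)
  then have dep: "g 0 *s u i - f 0 *s u j = 0" unfolding h .
  let ?e = "\<lambda>k. (if k = i then g 0 else 0) - (if k = j then f 0 else 0)"
  have "(\<Sum>k=0..d. ?e k *s u k) = (\<Sum>k=0..d. if k = i then g 0 *s u k else 0) -
      (\<Sum>k=0..d. if k = j then f 0 *s u k else 0)"
    unfolding sum_subtractf[symmetric]
    by (intro sum.cong) (auto simp: scale_left_diff_distrib)
  also have "\<dots> = 0" using dep ij by simp
  finally have "\<forall>k\<le>d. ?e k = 0" unfolding basis_family_sum_eq_0_iff[OF u] .
  from this[rule_format, of i] have "g 0 = 0" using ij by simp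
  \<comment> \<open>The chosen combination may be trivial; but then \<open>u j\<close> itself has vanishing first coordinate.\<close>
  moreover have "X (u j) = t j *s u j" using mat_represents_diag_eigenvector[OF diag] ij by simp
  ultimately have "u j = 0"
    using irreducible_tridiagonal_eigenvector_eq_0[OF lin w rep irr, of g "t j"] unfolding g by simp
  then show False using basis_family_nonzero[OF u] ij by simp
qed

section \<open>The null space of the commutator\<close>

text \<open>
  In coordinates the commutator acts by a two-step recurrence with \<open>p i = c i * (t (i - 1) - t i)\<close>
  and \<open>q i = b i * (t i - t (i + 1))\<close>; distinct consecutive \<open>t i\<close> make every \<open>q i\<close> with \<open>i < d\<close>
  invertible. Since \<open>X\<close> and \<open>Z\<close> are arbitrary, the lemma serves both claims of the theorem.
\<close>

lemma null_space_commutator: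
  assumes linX: "Vector_Spaces.linear scale scale X" and linZ: "Vector_Spaces.linear scale scale Z"
    and u: "basis_family scale d u"
    and rep: "mat_represents scale d u Y X" and irr: "irreducible_tridiagonal_mat Y"
    and entries: "\<forall>i\<in>{1..d}. Y $$ (i - 1, i) = b (i - 1) \<and> Y $$ (i, i - 1) = c i"
    and diag: "mat_represents scale d u (mat_diag (d + 1) t) Z"
    and distinct: "\<And>i. i < d \<Longrightarrow> t i \<noteq> t (i + 1)" and d: "even d"
  shows "null_space (\<lambda>x. X (Z x) - Z (X x)) =
    span {\<Sum>k=0..d. (if odd k then 0
      else \<Prod>i\<in>{i. 1 \<le> i \<and> i \<le> k - 1 \<and> odd i}.
        (c i * (t (i - 1) - t i)) / (b i * (t i - t (i + 1)))) *s u k}"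
proof -
  have Y: "Y \<in> carrier_mat (d + 1) (d + 1)" and tri: "tridiagonal_mat Y"
    using rep irr unfolding mat_represents_def irreducible_tridiagonal_mat_def by auto
  define p where "p i = c i * (t (i - 1) - t i)" for i
  define q where "q i = b i * (t i - t (i + 1))" for i
  define g where "g k = (if odd k then 0
    else \<Prod>i\<in>{i. 1 \<le> i \<and> i \<le> k - 1 \<and> odd i}. p i / q i)" for k
  have super: "Y $$ (i, i + 1) = b i" if "i < d" for i
    using entries[rule_format, of "i + 1"] that by simp
  have q: "q i \<noteq> 0" if "i < d" for i
    using irr Y that super[OF that] distinct[OF that]
    unfolding q_def irreducible_tridiagonal_mat_def by auto
  have coord: "(\<Sum>j=0..d. Y $$ (i, j) * (t j * a j)) - t i * (\<Sum>j=0..d. Y $$ (i, j) * a j) =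
      (if i = 0 then 0 else p i * a (i - 1)) - (if i < d then q i * a (i + 1) else 0)"
    if "i \<le> d" for i a
  proof -
    have "Y $$ (i, i - 1) = c i" if "i \<noteq> 0" using entries \<open>i \<le> d\<close> that by simp
    then show ?thesis
      unfolding tridiagonal_mat_row_sum[OF Y tri that] p_def q_def
      using super[of i] by (auto simp: algebra_simps)
  qed
  have kernel: "X (Z (\<Sum>k=0..d. a k *s u k)) - Z (X (\<Sum>k=0..d. a k *s u k)) = 0 \<longleftrightarrow>
      (\<forall>k\<le>d. a k = a 0 * g k)" for a
  proof -
    have "X (Z (\<Sum>k=0..d. a k *s u k)) - Z (X (\<Sum>k=0..d. a k *s u k)) =
      (\<Sum>i=0..d. ((\<Sum>j=0..d. Y $$ (i, j) * (t j * a j)) - t i * (\<Sum>j=0..d. Y $$ (i, j) * a j)) *s u i)"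
      unfolding mat_represents_diag_sum[OF linZ diag] mat_represents_sum[OF linX rep]
      by (simp add: scale_left_diff_distrib sum_subtractf)
    then have "X (Z (\<Sum>k=0..d. a k *s u k)) - Z (X (\<Sum>k=0..d. a k *s u k)) = 0 \<longleftrightarrow>
      (\<forall>i\<le>d. (\<Sum>j=0..d. Y $$ (i, j) * (t j * a j)) - t i * (\<Sum>j=0..d. Y $$ (i, j) * a j) = 0)"
      by (simp only: basis_family_sum_eq_0_iff[OF u])
    also have "\<dots> \<longleftrightarrow> (\<forall>i\<le>d. (if i = 0 then 0 else p i * a (i - 1)) =
        (if i < d then q i * a (i + 1) else 0))"
      by (simp only: coord right_minus_eq cong: imp_cong)
    also have "\<dots> \<longleftrightarrow> (\<forall>k\<le>d. a k = a 0 * g k)"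
      unfolding g_def by (rule two_step_recurrence_iff[OF q d])
    finally show ?thesis .
  qed
  have "null_space (\<lambda>x. X (Z x) - Z (X x)) = span {\<Sum>k=0..d. g k *s u k}"
  proof (rule subset_antisym; rule subsetI)
    fix x assume x: "x \<in> null_space (\<lambda>x. X (Z x) - Z (X x))"
    obtain a where a: "x = (\<Sum>k=0..d. a k *s u k)" by (rule basis_family_expansion[OF u])
    have "\<forall>k\<le>d. a k = a 0 * g k"
      using x unfolding null_space_def a mem_Collect_eq kernel .
    note a_eq = this[rule_format]
    have "x = (\<Sum>k=0..d. (a 0 * g k) *s u k)" 
      unfolding a by (intro sum.cong refl arg_cong2[where f = scale] a_eq) auto
    then have "x = a 0 *s (\<Sum>k=0..d. g k *s u k)" by (simp add: scale_sum_right)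
    then show "x \<in> span {\<Sum>k=0..d. g k *s u k}" by (auto simp: span_singleton)
  next
    fix x assume "x \<in> span {\<Sum>k=0..d. g k *s u k}"
    then obtain r where "x = r *s (\<Sum>k=0..d. g k *s u k)" by (auto simp: span_singleton)
    then have x: "x = (\<Sum>k=0..d. (r * g k) *s u k)" by (simp add: scale_sum_right)
    have "{i::nat. 1 \<le> i \<and> i \<le> 0 - 1 \<and> odd i} = {}" by auto
    then have "g 0 = 1" unfolding g_def by (simp only: prod.empty) simp
    then show "x \<in> null_space (\<lambda>x. X (Z x) - Z (X x))"
      unfolding null_space_def mem_Collect_eq x kernel by simp
  qed
  then show ?thesis unfolding g_def p_def q_def .
qed

end

theorem theorem1p5:
  fixes scale :: "'k::field \<Rightarrow> 'v::ab_group_add \<Rightarrow> 'v"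
    and A As :: "'v \<Rightarrow> 'v"
    and d :: nat
    and vs v :: "nat \<Rightarrow> 'v"
    and B Bs :: "'k mat"
    and b c \<theta>s bs cs \<theta> :: "nat \<Rightarrow> 'k"
  assumes "vector_space scale"
    and "0 < vector_space.dim scale (UNIV :: 'v set)"
    and "leonard_pair scale A As"
    and "d = vector_space.dim scale (UNIV :: 'v set) - 1"
    and "basis_family scale d vs"
    and "mat_represents scale d vs B A"
    and "irreducible_tridiagonal_mat B"
    and "\<forall>i\<in>{1..d}. B $$ (i - 1, i) = b (i - 1) \<and> B $$ (i, i - 1) = c i"
    and "mat_represents scale d vs (mat_diag (d + 1) \<theta>s) As"
    and "basis_family scale d v"
    and "mat_represents scale d v Bs As"
    and "irreducible_tridiagonal_mat Bs"
    and "\<forall>i\<in>{1..d}. Bs $$ (i - 1, i) = bs (i - 1) \<and> Bs $$ (i, i - 1) = cs i"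
    and "mat_represents scale d v (mat_diag (d + 1) \<theta>) A"
    and "even d"
  shows "(null_space (\<lambda>x. A (As x) - As (A x)) =
           module.span scale {\<Sum>k=0..d. scale
             (if odd k then 0
              else \<Prod>i\<in>{i. 1 \<le> i \<and> i \<le> k - 1 \<and> odd i}.
                     (c i * (\<theta>s (i - 1) - \<theta>s i)) / (b i * (\<theta>s i - \<theta>s (i + 1)))) (vs k)}) \<and>
         (null_space (\<lambda>x. A (As x) - As (A x)) =
           module.span scale {\<Sum>k=0..d. scale
             (if odd k then 0
              else \<Prod>i\<in>{i. 1 \<le> i \<and> i \<le> k - 1 \<and> odd i}.
                     (cs i * (\<theta> (i - 1) - \<theta> i)) / (bs i * (\<theta> i - \<theta> (i + 1)))) (v k)})"
proof -
  interpret vector_space scale by fact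
  have linA: "Vector_Spaces.linear scale scale A" and linAs: "Vector_Spaces.linear scale scale As"
    using \<open>leonard_pair scale A As\<close> unfolding leonard_pair_def by auto
  have "inj_on \<theta>s {0..d}" by (rule diagonal_entries_distinct) fact+
  then have \<theta>s: "\<theta>s i \<noteq> \<theta>s (i + 1)" if "i < d" for i
    using that by (auto dest: inj_onD[of _ _ i "i + 1"])
  have "inj_on \<theta> {0..d}" by (rule diagonal_entries_distinct) fact+
  then have \<theta>: "\<theta> i \<noteq> \<theta> (i + 1)" if "i < d" for i
    using that by (auto dest: inj_onD[of _ _ i "i + 1"])
  have swap: "null_space (\<lambda>x. A (As x) - As (A x)) = null_space (\<lambda>x. As (A x) - A (As x))"
    unfolding null_space_def by (auto simp: algebra_simps)
  show ?thesis
  proof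
    show "null_space (\<lambda>x. A (As x) - As (A x)) =
           module.span scale {\<Sum>k=0..d. scale
             (if odd k then 0
              else \<Prod>i\<in>{i. 1 \<le> i \<and> i \<le> k - 1 \<and> odd i}.
                     (c i * (\<theta>s (i - 1) - \<theta>s i)) / (b i * (\<theta>s i - \<theta>s (i + 1)))) (vs k)}"
      by (rule null_space_commutator[of A As d vs B b c \<theta>s]) (fact | erule \<theta>s)+
    show "null_space (\<lambda>x. A (As x) - As (A x)) =
           module.span scale {\<Sum>k=0..d. scale
             (if odd k then 0
              else \<Prod>i\<in>{i. 1 \<le> i \<and> i \<le> k - 1 \<and> odd i}.
                     (cs i * (\<theta> (i - 1) - \<theta> i)) / (bs i * (\<theta> i - \<theta> (i + 1)))) (v k)}"
      unfolding swap
      by (rule null_space_commutator[of As A d v Bs bs cs \<theta>]) (fact | erule \<theta>)+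
  qed
qed

end
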